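(* Let $\kappa$ be a cardinal such that $\kappa>\mathfrak{c}$, and let $\tau=\log\kappa$. For a subset $S$ of an abelian group $G$, the following conditions are equivalent: (i) there exists a group homomorphism $\varpi:G\to \mathbb{T}^\kappa$ such that $\varpi(S)$ is dense in $\mathbb{T}^\kappa$; (ii) $\tau\le \min\{|nS|:n\in\mathbb{N}\}$; (iii) $S$ is $\tau$-wide.
   Context: $\mathbb{N}$ is the set of positive integers, $\mathfrak{c}$ is the cardinality of the continuum, and $\mathbb{T}=\mathbb{R}/\mathbb{Z}$ is the circle group with its usual topology; $\mathbb{T}^\kappa$ carries the product topology. For an infinite cardinal $\kappa$, $\log\kappa=\min\{\tau\ge\omega:\kappa\le 2^\tau\}$. For a subset $X$ of an abelian group, $nX=\{nx:x\in X\}$ and $\langle X\rangle$ is the subgroup generated by $X$. For an infinite cardinal $\tau$, a subset $S$ of an abelian group $G$ is $\tau$-wide if $nS\setminus\langle S'\rangle\neq\emptyset$ for every $n\in\mathbb{N}$ and each $S'\subseteq S$ with $|S'|<\tau$. *)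

theory Defs
  imports
    "HOL-Analysis.Analysis"
    "HOL-Library.Function_Algebras"
    "HOL-Computational_Algebra.Group_Closure"
begin

unbundle cardinal_syntax

section \<open>The circle group\<close>

quotient_type circle = real / "\<lambda>x y :: real. x - y \<in> \<int>"
  morphisms rep_circle circle_of
proof (rule equivpI)
  show "reflp (\<lambda>x y :: real. x - y \<in> \<int>)"
    by (rule reflpI) simp
  show "symp (\<lambda>x y :: real. x - y \<in> \<int>)"
    by (rule sympI) (metis Ints_minus minus_diff_eq)
  show "transp (\<lambda>x y :: real. x - y \<in> \<int>)"
  proof (rule transpI)
    fix x y z :: real
    assume "x - y \<in> \<int>" "y - z \<in> \<int>"
    then have "(x - y) + (y - z) \<in> \<int>" by (rule Ints_add)
    then show "x - z \<in> \<int>" by simp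
  qed
qed

instantiation circle :: ab_group_add
begin

lift_definition zero_circle :: circle is "0 :: real" .

lift_definition plus_circle :: "circle \<Rightarrow> circle \<Rightarrow> circle" is "(+) :: real \<Rightarrow> real \<Rightarrow> real"
proof -
  fix a b c d :: real
  assume "a - b \<in> \<int>" "c - d \<in> \<int>"
  then have "(a - b) + (c - d) \<in> \<int>" by (rule Ints_add)
  then show "a + c - (b + d) \<in> \<int>" by (simp add: algebra_simps)
qed

lift_definition uminus_circle :: "circle \<Rightarrow> circle" is "uminus :: real \<Rightarrow> real"
proof -
  fix a b :: real
  assume "a - b \<in> \<int>"
  then have "- (a - b) \<in> \<int>" by (rule Ints_minus)
  then show "- a - - b \<in> \<int>" by simp
qed

lift_definition minus_circle :: "circle \<Rightarrow> circle \<Rightarrow> circle" is "(-) :: real \<Rightarrow> real \<Rightarrow> real"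
proof -
  fix a b c d :: real
  assume "a - b \<in> \<int>" "c - d \<in> \<int>"
  then have "(a - b) - (c - d) \<in> \<int>" by (rule Ints_diff)
  then show "a - c - (b - d) \<in> \<int>" by (simp add: algebra_simps)
qed

instance
  by standard (transfer; simp)+

end

text \<open>The quotient topology of \<open>\<real>\<close> modulo \<open>\<int>\<close>.\<close>

instantiation circle :: topological_space
begin

definition open_circle :: "circle set \<Rightarrow> bool"
  where "open_circle U \<longleftrightarrow> open (circle_of -` U)"

instance
  by standard (auto simp: open_circle_def vimage_Int vimage_Union)

end

section \<open>Cardinals\<close>

text \<open>The least member of a set of cardinals, which is determined up to \<open>=o\<close>.\<close>

definition min_card :: "'a rel set \<Rightarrow> 'a rel"
  where "min_card R = (SOME r. r \<in> R \<and> (\<forall>s\<in>R. r \<le>o s))"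

lemma min_card:
  assumes "R \<noteq> {}" "\<And>r. r \<in> R \<Longrightarrow> Card_order r"
  shows "min_card R \<in> R" "\<And>s. s \<in> R \<Longrightarrow> min_card R \<le>o s"
proof -
  have "\<exists>r. r \<in> R \<and> (\<forall>s\<in>R. r \<le>o s)"
    using exists_minim_Card_order[of R] assms by blast
  then have "min_card R \<in> R \<and> (\<forall>s\<in>R. min_card R \<le>o s)"
    unfolding min_card_def by (rule someI_ex)
  then show "min_card R \<in> R" "\<And>s. s \<in> R \<Longrightarrow> min_card R \<le>o s" by auto
qed

text \<open>
  The minimum is taken over cardinals on the underlying type of \<open>\<kappa>\<close>. For an infinite cardinal
  \<open>\<kappa>\<close> this is no restriction, since \<open>\<kappa> \<le> 2 ^ \<kappa>\<close>; see \<open>log_card_least\<close> below, where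
  \<open>\<sigma>\<close> is a cardinal on an arbitrary type.
\<close>

definition log_card :: "'a rel \<Rightarrow> 'a rel"
  where "log_card \<kappa> = min_card {\<tau>. Card_order \<tau> \<and> natLeq \<le>o \<tau> \<and> \<kappa> \<le>o ctwo ^c \<tau>}"

lemma
  fixes \<kappa> :: "'a rel"
  assumes "Card_order \<kappa>" "natLeq \<le>o \<kappa>"
  shows Card_order_log_card: "Card_order (log_card \<kappa>)"
    and log_card_infinite: "natLeq \<le>o log_card \<kappa>"
    and log_card_exp: "\<kappa> \<le>o ctwo ^c log_card \<kappa>"
    and log_card_least: "\<And>\<sigma> :: 'b rel.
      Card_order \<sigma> \<Longrightarrow> natLeq \<le>o \<sigma> \<Longrightarrow> \<kappa> \<le>o ctwo ^c \<sigma> \<Longrightarrow> log_card \<kappa> \<le>o \<sigma>"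
proof -
  let ?R = "{\<tau> :: 'a rel. Card_order \<tau> \<and> natLeq \<le>o \<tau> \<and> \<kappa> \<le>o ctwo ^c \<tau>}"
  have \<kappa>: "\<kappa> \<in> ?R"
    using assms ordLess_ctwo_cexp[of \<kappa>] ordLess_imp_ordLeq by blast
  have min: "log_card \<kappa> \<in> ?R" "\<And>s. s \<in> ?R \<Longrightarrow> log_card \<kappa> \<le>o s"
    using min_card[of ?R] \<kappa> unfolding log_card_def by blast+
  then show "Card_order (log_card \<kappa>)" "natLeq \<le>o log_card \<kappa>" "\<kappa> \<le>o ctwo ^c log_card \<kappa>"
    by auto
  fix \<sigma> :: "'b rel"
  assume \<sigma>: "Card_order \<sigma>" "natLeq \<le>o \<sigma>" "\<kappa> \<le>o ctwo ^c \<sigma>"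
  show "log_card \<kappa> \<le>o \<sigma>"
  proof (cases "\<kappa> \<le>o \<sigma>")
    case True
    then show ?thesis using min(2)[OF \<kappa>] ordLeq_transitive by blast
  next
    case False
    then have "\<sigma> \<le>o \<kappa>"
      using assms(1) \<sigma>(1) by (meson Card_order_iff_ordLeq_card_of card_order_on_well_order_on
          ordLeq_total)
    then obtain \<rho> :: "'a rel" where \<rho>: "\<sigma> =o \<rho>"
      using internalize_ordLeq[of \<sigma> \<kappa>] by blast
    have "Card_order \<rho>" using \<rho> \<sigma>(1) Card_order_ordIso2 by blast
    moreover have "natLeq \<le>o \<rho>" using \<rho> \<sigma>(2) ordLeq_ordIso_trans by blast
    moreover have "\<kappa> \<le>o ctwo ^c \<rho>"
      using \<sigma>(3) cexp_cong2[OF \<rho> Card_order_ctwo \<sigma>(1)] ordLeq_ordIso_trans by blast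
    ultimately have "log_card \<kappa> \<le>o \<rho>" using min(2) by blast
    then show ?thesis using \<rho> ordIso_symmetric ordLeq_ordIso_trans by blast
  qed
qed

section \<open>Wide sets\<close>

text \<open>The integer multiple \<open>n x\<close> in an abelian group.\<close>

definition nmult :: "nat \<Rightarrow> 'a::ab_group_add \<Rightarrow> 'a"
  where "nmult n x = (\<Sum>i<n. x)"

definition wide :: "'c rel \<Rightarrow> 'a::ab_group_add set \<Rightarrow> bool"
  where "wide \<tau> S \<longleftrightarrow>
    (\<forall>n>0. \<forall>S'\<subseteq>S. |S'| <o \<tau> \<longrightarrow> nmult n ` S - group_closure S' \<noteq> {})"

end

theory Submission
  imports Defs
begin

text \<open>
  Since \<open>\<kappa>\<close> exceeds the continuum, the cardinal \<open>\<tau>\<close> is uncountable, so that passing from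
  a set to the subgroup it generates cannot bring its cardinality up to \<open>\<tau>\<close>; this makes
  wideness a condition on the cardinalities of the sets \<open>n S\<close>. These are at least \<open>\<tau>\<close>
  when \<open>\<phi> S\<close> is dense, since then so is \<open>n (\<phi> S)\<close>, and a dense set \<open>D\<close> forces
  \<open>\<kappa> \<le> 2\<^bsup>|D|\<^esup>\<close>. Conversely, let \<open>S\<close> be wide
  and let \<open>t\<^sub>\<alpha>\<close> (\<open>\<alpha> < \<tau>\<close>) enumerate a dense family in the power of the circle, with precisions
  \<open>N\<^sub>\<alpha>\<close>. Choose \<open>s\<^sub>\<alpha> \<in> S\<close> recursively so that its order modulo the subgroup generated by the
  earlier ones exceeds \<open>N\<^sub>\<alpha>\<close>. A character of that subgroup then extends to \<open>s\<^sub>\<alpha>\<close> with a value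
  within \<open>1 / N\<^sub>\<alpha>\<close> of any prescribed one, so there is a homomorphism with \<open>\<phi> s\<^sub>\<alpha>\<close> uniformly
  within \<open>1 / N\<^sub>\<alpha>\<close> of \<open>t\<^sub>\<alpha>\<close>.
\<close>

section \<open>Multiples and the circle\<close>

lemma nmult_0 [simp]: "nmult 0 x = 0"
  by (simp add: nmult_def)

lemma nmult_Suc [simp]: "nmult (Suc n) x = x + nmult n x"
  by (simp add: nmult_def)

lemma nmult_add: "nmult (m + n) x = nmult m x + nmult n x"
  by (induction m) (simp_all add: add_ac)

lemma nmult_mult: "nmult (m * n) x = nmult m (nmult n x)"
  by (induction m) (simp_all add: nmult_add)

lemma nmult_zero_right [simp]: "nmult n 0 = 0"
  by (induction n) simp_all

lemma circle_of_eq_iff: "circle_of x = circle_of y \<longleftrightarrow> x - y \<in> \<int>"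
  by (rule circle.abs_eq_iff)

lemma circle_of_add: "circle_of (x + y) = circle_of x + circle_of y"
  by (simp add: plus_circle.abs_eq)

lemma circle_of_diff: "circle_of (x - y) = circle_of x - circle_of y"
  by (simp add: minus_circle.abs_eq)

lemma circle_of_0 [simp]: "circle_of 0 = 0"
  by (simp add: zero_circle_def)

lemma circle_of_surj: "\<exists>x. c = circle_of x"
  using Quotient_abs_rep[OF Quotient_circle, of c] by metis

lemma nmult_circle_of: "nmult n (circle_of x) = circle_of (real n * x)"
  by (induction n) (simp_all add: circle_of_add algebra_simps)

lemma additive_nmult:
  assumes "Modules.additive f"
  shows "f (nmult n x) = nmult n (f x)"
  by (induction n) (simp_all add: additive.zero[OF assms] additive.add[OF assms])

text \<open>The full preimage of an image is the union of the integer translates of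
  \<open>A\<close>, and translates of open sets are open. This supplies arcs as open sets of the
  quotient topology.\<close>

lemma open_circle_of_image:
  assumes "open A"
  shows "open (circle_of ` A)"
proof -
  have "circle_of -` circle_of ` A = (\<Union>i\<in>\<int>. (+) i ` A)"
  proof (intro equalityI subsetI)
    fix x assume "x \<in> circle_of -` circle_of ` A"
    then obtain a where "a \<in> A" "x - a \<in> \<int>" by (auto simp: circle_of_eq_iff)
    then show "x \<in> (\<Union>i\<in>\<int>. (+) i ` A)" by (intro UN_I[of "x - a"] image_eqI[of _ _ a]) auto
  next
    fix x assume "x \<in> (\<Union>i\<in>\<int>. (+) i ` A)"
    then obtain i a where "i \<in> \<int>" "a \<in> A" "x = i + a" by auto
    then show "x \<in> circle_of -` circle_of ` A"
      by (auto simp: circle_of_eq_iff intro!: image_eqI[of _ _ a])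
  qed
  moreover have "open (\<Union>i\<in>\<int>. (+) i ` A)"
    using assms open_translation by blast
  ultimately show ?thesis by (simp add: open_circle_def)
qed

section \<open>Integer multiples in an abelian group\<close>

definition zmult :: "int \<Rightarrow> 'a::ab_group_add \<Rightarrow> 'a"
  where "zmult k x = nmult (nat k) x - nmult (nat (- k)) x"

text \<open>Every integer is a difference of naturals, and the right-hand side is independent of the
  representation chosen. The laws of \<open>zmult\<close> thus reduce to those of
  \<open>nmult\<close> without case distinctions on signs.\<close>

lemma zmult_diff_nat: "zmult (int m - int n) x = nmult m x - nmult n x"
proof (cases "m \<ge> n")
  case True
  then obtain d where "m = n + d" using le_Suc_ex by blast
  then show ?thesis by (simp add: zmult_def nmult_add)
next
  case False
  then obtain d where "n = m + d" using le_Suc_ex by (metis nat_le_linear)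
  then show ?thesis by (simp add: zmult_def nmult_add)
qed

lemma zmult_int [simp]: "zmult (int n) x = nmult n x"
  using zmult_diff_nat[of n 0 x] by simp

lemma zmult_0 [simp]: "zmult 0 x = 0"
  by (simp add: zmult_def)

lemma zmult_1 [simp]: "zmult 1 x = x"
  by (simp add: zmult_def)

lemma zmult_diff: "zmult (a - b) x = zmult a x - zmult b x"
proof -
  obtain m n where a: "a = int m - int n" by (rule int_diff_cases)
  obtain p q where b: "b = int p - int q" by (rule int_diff_cases)
  have "a - b = int (m + q) - int (n + p)" by (simp add: a b)
  then have "zmult (a - b) x = nmult (m + q) x - nmult (n + p) x" by (simp only: zmult_diff_nat)
  then show ?thesis by (simp add: a b zmult_diff_nat nmult_add)
qed

lemma zmult_minus: "zmult (- a) x = - zmult a x"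
  using zmult_diff[of 0 a x] by simp

lemma zmult_mult_int: "zmult (a * int n) x = zmult a (nmult n x)"
proof -
  obtain m k where a: "a = int m - int k" by (rule int_diff_cases)
  have "a * int n = int (m * n) - int (k * n)" by (simp add: a algebra_simps)
  then have "zmult (a * int n) x = nmult (m * n) x - nmult (k * n) x"
    by (simp only: zmult_diff_nat)
  then show ?thesis by (simp add: a zmult_diff_nat nmult_mult)
qed

lemma zmult_circle_of: "zmult k (circle_of x) = circle_of (of_int k * x)"
proof -
  obtain m n where k: "k = int m - int n" by (rule int_diff_cases)
  show ?thesis
    by (simp add: k zmult_diff_nat nmult_circle_of circle_of_diff[symmetric] algebra_simps)
qed

lemma zmult_in_group_closure:
  assumes "x \<in> group_closure A"
  shows "zmult k x \<in> group_closure A"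
proof -
  have "nmult n x \<in> group_closure A" for n
    by (induction n) (simp_all add: assms group_closure_add)
  then show ?thesis by (simp add: zmult_def group_closure.diff)
qed

lemma group_closure_mono: "A \<subseteq> B \<Longrightarrow> group_closure A \<subseteq> group_closure B"
proof
  fix x show "x \<in> group_closure B" if "A \<subseteq> B" "x \<in> group_closure A"
    using that(2,1) by induction (auto intro: group_closure.intros)
qed

section \<open>Extending characters\<close>

text \<open>A homomorphism from a subgroup to the circle, given by its graph.\<close>

definition partial_character :: "('a::ab_group_add \<times> circle) set \<Rightarrow> bool"
  where "partial_character f \<longleftrightarrow>
    (0, 0) \<in> f \<and> (\<forall>p\<in>f. \<forall>q\<in>f. p - q \<in> f) \<and> (\<forall>y. (0, y) \<in> f \<longrightarrow> y = 0)"

lemma partial_character_trivial: "partial_character {(0, 0)}"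
  by (auto simp: partial_character_def zero_prod_def)

lemma partial_character_diff:
  "partial_character f \<Longrightarrow> (x, y) \<in> f \<Longrightarrow> (x', y') \<in> f \<Longrightarrow> (x - x', y - y') \<in> f"
  unfolding partial_character_def by fastforce

lemma partial_character_add:
  assumes "partial_character f" "(x, y) \<in> f" "(x', y') \<in> f"
  shows "(x + x', y + y') \<in> f"
proof -
  have "(0, 0) \<in> f" using assms(1) by (simp add: partial_character_def)
  then have "(0 - x', 0 - y') \<in> f" using assms partial_character_diff by blast
  then have "(x - (0 - x'), y - (0 - y')) \<in> f" using assms partial_character_diff by blast
  then show ?thesis by simp
qed

lemma partial_character_unique:
  assumes "partial_character f" "(x, y) \<in> f" "(x, y') \<in> f"
  shows "y = y'"
  using partial_character_diff[OF assms] assms(1) by (auto simp: partial_character_def)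

lemma partial_character_zmult:
  assumes "partial_character f" "(x, y) \<in> f"
  shows "(zmult k x, zmult k y) \<in> f"
proof -
  have "(nmult n x, nmult n y) \<in> f" for n
    using assms
    by (induction n) (auto intro: partial_character_add simp: partial_character_def)
  then show ?thesis
    unfolding zmult_def by (intro partial_character_diff[OF assms(1)])
qed

text \<open>Any two pairs of the union already lie in one member of the chain, where subtraction is
  available. This is the upper bound for both applications of Zorn's lemma below.\<close>

lemma partial_character_Union:
  assumes "\<C> \<noteq> {}" "subset.chain \<A> \<C>" "\<And>f. f \<in> \<C> \<Longrightarrow> partial_character f"
  shows "partial_character (\<Union>\<C>)"
  unfolding partial_character_def
proof (intro conjI ballI)
  show "(0, 0) \<in> \<Union>\<C>"
    using assms by (auto simp: partial_character_def)
  show "\<forall>y. (0, y) \<in> \<Union>\<C> \<longrightarrow> y = 0"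
    using assms(3) by (auto simp: partial_character_def)
  fix p q assume "p \<in> \<Union>\<C>" "q \<in> \<Union>\<C>"
  then obtain f g where "f \<in> \<C>" "p \<in> f" "g \<in> \<C>" "q \<in> g" by blast
  moreover have "f \<subseteq> g \<or> g \<subseteq> f"
    using assms(2) \<open>f \<in> \<C>\<close> \<open>g \<in> \<C>\<close> by (auto simp: subset_chain_def)
  ultimately obtain h where "h \<in> \<C>" "p \<in> h" "q \<in> h" by blast
  then show "p - q \<in> \<Union>\<C>"
    using assms(3) by (auto simp: partial_character_def)
qed

text \<open>
  If \<open>N > n\<close> is the order of \<open>e\<close> modulo the domain, the admissible values at \<open>e\<close> are
  the \<open>N\<close>-th parts of a given element of the circle, hence a translate of the \<open>N\<close>-torsion.
\<close>

lemma partial_character_value: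
  fixes e :: "'a::ab_group_add" and t :: real
  assumes f: "partial_character f"
    and n: "\<And>m. 0 < m \<Longrightarrow> m \<le> n \<Longrightarrow> nmult m e \<notin> fst ` f"
  obtains z where "real n * \<bar>z - t\<bar> \<le> 1"
    and "\<And>k y. (zmult k e, y) \<in> f \<Longrightarrow> y = zmult k (circle_of z)"
proof (cases "\<exists>m>0. nmult m e \<in> fst ` f")
  case False
  \<comment> \<open>With \<open>e\<close> of infinite order modulo the domain only
    \<open>k = 0\<close> can occur, so \<open>t\<close> itself is admissible.\<close>
  have "y = zmult k (circle_of t)" if "(zmult k e, y) \<in> f" for k y
  proof -
    have "(zmult (- k) e, - y) \<in> f"
      using partial_character_zmult[OF f that, of "- 1"] by (simp add: zmult_minus)
    then have "nmult (nat \<bar>k\<bar>) e \<in> fst ` f"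
      using that by (cases "k \<ge> 0") (force simp: zmult_def)+
    then have "k = 0" using False by (metis not_gr_zero zero_less_abs_iff zero_less_nat_eq)
    then show ?thesis using that f by (auto simp: partial_character_def)
  qed
  then show ?thesis using that[of t] by simp
next
  case True
  define N where "N = (LEAST m. 0 < m \<and> nmult m e \<in> fst ` f)"
  have "0 < N \<and> nmult N e \<in> fst ` f"
    unfolding N_def using True by (rule LeastI_ex)
  then have N: "N > 0" "nmult N e \<in> fst ` f" by auto
  have N_le: "N \<le> m" if "0 < m" "nmult m e \<in> fst ` f" for m
    unfolding N_def using that by (intro Least_le) auto
  have "n < N" using n[of N] N by force
  obtain c where c: "(nmult N e, circle_of c) \<in> f"
  proof -
    obtain y where "(nmult N e, y) \<in> f" using N(2) by force
    moreover obtain c where "y = circle_of c" using circle_of_surj by blast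
    ultimately show ?thesis using that by simp
  qed
  \<comment> \<open>Any \<open>z\<close> with \<open>N z\<close> congruent to \<open>c\<close>
    modulo 1 is admissible. Rounding \<open>N t - c\<close> to an integer \<open>l\<close> selects
    one with \<open>N z\<close> within 1 of \<open>N t\<close>.\<close>
  define l where "l = \<lfloor>real N * t - c\<rfloor>"
  define z where "z = (c + of_int l) / real N"
  have Nz: "real N * z = c + of_int l" using N by (simp add: z_def)
  have "real N * \<bar>z - t\<bar> = \<bar>real N * z - real N * t\<bar>"
    by (metis abs_mult abs_of_nat right_diff_distrib)
  also have "\<dots> \<le> 1" unfolding Nz l_def by linarith
  finally have "real N * \<bar>z - t\<bar> \<le> 1" .
  moreover have "real n * \<bar>z - t\<bar> \<le> real N * \<bar>z - t\<bar>"
    using \<open>n < N\<close> by (intro mult_right_mono) auto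
  ultimately have 1: "real n * \<bar>z - t\<bar> \<le> 1" by linarith
  have "y = zmult k (circle_of z)" if y: "(zmult k e, y) \<in> f" for k y
  proof -
    define q where "q = k div int N"
    have q: "(zmult (q * int N) e, circle_of (of_int q * c)) \<in> f"
      using partial_character_zmult[OF f c, of q] by (simp add: zmult_mult_int zmult_circle_of)
    \<comment> \<open>The remainder of \<open>k\<close> also multiplies \<open>e\<close> into the
      domain, so it vanishes by minimality of \<open>N\<close>.\<close>
    have "k mod int N = k - q * int N" by (simp add: q_def minus_div_mult_eq_mod)
    then have "zmult (k mod int N) e \<in> fst ` f"
      using partial_character_diff[OF f y q] by (force simp: zmult_diff)
    moreover have "zmult (k mod int N) e = nmult (nat (k mod int N)) e"
      using N(1) by (simp add: zmult_def)
    ultimately have mem: "nmult (nat (k mod int N)) e \<in> fst ` f" by simp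
    have "0 \<le> k mod int N" "k mod int N < int N" using N(1) by simp_all
    then have "k mod int N = 0" using N_le[OF _ mem] by linarith
    then have k: "k = q * int N"
      using div_mult_mod_eq[of k "int N"] by (simp add: q_def)
    have "y = circle_of (of_int q * c)"
      using partial_character_unique[OF f] y q k by blast
    also have "\<dots> = circle_of (of_int k * z)"
    proof -
      have "of_int k * z = of_int q * (real N * z)" by (simp add: k)
      then have "of_int k * z = of_int q * (c + of_int l)" by (simp only: Nz)
      then have "of_int q * c - of_int k * z = - of_int (q * l)" by (simp add: algebra_simps)
      then show ?thesis by (simp add: circle_of_eq_iff)
    qed
    finally show ?thesis by (simp add: zmult_circle_of)
  qed
  then show ?thesis using that 1 by blast
qed

text \<open>Adding all multiples of \<open>(e, circle_of z)\<close> to the graph gives a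
  homomorphism as soon as \<open>z\<close> agrees with \<open>f\<close> on the multiples of
  \<open>e\<close> in its domain, which \<open>partial_character_value\<close> ensures. The bound on
  the new domain lets the construction along a well-order keep later elements free.\<close>

lemma partial_character_insert:
  fixes e :: "'a::ab_group_add" and t :: real
  assumes f: "partial_character f"
    and n: "\<And>m. 0 < m \<Longrightarrow> m \<le> n \<Longrightarrow> nmult m e \<notin> fst ` f"
  obtains f' z where "partial_character f'" "f \<subseteq> f'"
    "(e, circle_of z) \<in> f'" "real n * \<bar>z - t\<bar> \<le> 1"
    "fst ` f' \<subseteq> group_closure (insert e (fst ` f))"
proof -
  obtain z where z: "real n * \<bar>z - t\<bar> \<le> 1"
    and fz: "\<And>k y. (zmult k e, y) \<in> f \<Longrightarrow> y = zmult k (circle_of z)"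
    using partial_character_value[OF assms] by blast
  define f' where "f' = {(x + zmult k e, y + zmult k (circle_of z)) | x y k. (x, y) \<in> f}"
  have mem: "(x + zmult k e, y + zmult k (circle_of z)) \<in> f'" if "(x, y) \<in> f" for x y k
    using that by (auto simp: f'_def)
  have 0: "(0, 0) \<in> f" using f by (simp add: partial_character_def)
  have sub: "f \<subseteq> f'" using mem[where k = 0] by auto
  have "partial_character f'"
    unfolding partial_character_def
  proof (intro conjI ballI allI impI)
    show "(0, 0) \<in> f'" using 0 sub by blast
  next
    fix p q assume "p \<in> f'" "q \<in> f'"
    then obtain x y k x' y' k' where p: "p = (x + zmult k e, y + zmult k (circle_of z))"
      and q: "q = (x' + zmult k' e, y' + zmult k' (circle_of z))"
      and xy: "(x, y) \<in> f" "(x', y') \<in> f" by (auto simp: f'_def)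
    have "p - q = ((x - x') + zmult (k - k') e, (y - y') + zmult (k - k') (circle_of z))"
      by (simp add: p q zmult_diff)
    then show "p - q \<in> f'" using mem partial_character_diff[OF f xy] by metis
  next
    fix y assume "(0, y) \<in> f'"
    then obtain x y' k where *: "0 = x + zmult k e" "y = y' + zmult k (circle_of z)" "(x, y') \<in> f"
      by (auto simp: f'_def)
    \<comment> \<open>Here the new graph is seen to be single-valued: a representation of 0 places a
      multiple of \<open>e\<close> in the old domain, where \<open>z\<close> is compatible with
      \<open>f\<close>.\<close>
    have "x = zmult (- k) e" using *(1) by (simp add: zmult_minus eq_neg_iff_add_eq_0)
    then have "y' = zmult (- k) (circle_of z)" using fz *(3) by blast
    then show "y = 0" using *(2) by (simp add: zmult_minus)
  qed
  moreover have "(e, circle_of z) \<in> f'" using mem[OF 0, of 1] by simp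
  moreover have "fst ` f' \<subseteq> group_closure (insert e (fst ` f))"
  proof
    fix a assume "a \<in> fst ` f'"
    then obtain x y k where "a = x + zmult k e" "(x, y) \<in> f" by (auto simp: f'_def)
    then have "x \<in> group_closure (insert e (fst ` f))"
      by (force intro: group_closure.base)
    moreover have "zmult k e \<in> group_closure (insert e (fst ` f))"
      by (auto intro: zmult_in_group_closure group_closure.base)
    ultimately show "a \<in> group_closure (insert e (fst ` f))"
      using \<open>a = x + zmult k e\<close> by (simp add: group_closure_add)
  qed
  ultimately show ?thesis using that z sub by blast
qed

text \<open>The circle is divisible, so characters extend: a maximal extension is total, since
  \<open>partial_character_insert\<close> with \<open>n = 0\<close> adjoins any element without a
  condition on its order.\<close>

lemma partial_character_extend_UNIV:
  fixes f :: "('a::ab_group_add \<times> circle) set"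
  assumes "partial_character f"
  shows "\<exists>\<psi>. Modules.additive \<psi> \<and> (\<forall>(x, y)\<in>f. \<psi> x = y)"
proof -
  let ?A = "{g. partial_character g \<and> f \<subseteq> g}"
  have "\<exists>M\<in>?A. \<forall>X\<in>?A. M \<subseteq> X \<longrightarrow> X = M"
  proof (rule subset_Zorn_nonempty)
    show "?A \<noteq> {}" using assms by blast
    fix \<C> assume C: "\<C> \<noteq> {}" "subset.chain ?A \<C>"
    then have "\<C> \<subseteq> ?A" by (simp add: subset_chain_def)
    then show "\<Union>\<C> \<in> ?A" using C partial_character_Union[OF C] by blast
  qed
  then obtain M where "M \<in> ?A" and max: "\<forall>X\<in>?A. M \<subseteq> X \<longrightarrow> X = M" ..
  then have M: "partial_character M" "f \<subseteq> M" by simp_all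
  have total: "\<exists>y. (x, y) \<in> M" for x
  proof -
    obtain f' z where f': "partial_character f'" "M \<subseteq> f'" "(x, circle_of z) \<in> f'"
      by (rule partial_character_insert[OF M(1), where n = 0 and e = x and t = 0]) auto
    then have "f' = M" using max M(2) by simp
    then show ?thesis using f'(3) by blast
  qed
  define \<psi> where "\<psi> x = (SOME y. (x, y) \<in> M)" for x
  have \<psi>: "(x, \<psi> x) \<in> M" for x
    unfolding \<psi>_def using someI_ex[OF total] .
  show ?thesis
  proof (intro exI[of _ \<psi>] conjI)
    show "Modules.additive \<psi>"
      using partial_character_unique[OF M(1) \<psi> partial_character_add[OF M(1) \<psi> \<psi>]]
      by (simp add: Modules.additive_def)
    show "\<forall>(x, y)\<in>f. \<psi> x = y"
      using partial_character_unique[OF M(1) \<psi>] M(2) by blast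
  qed
qed

section \<open>Characters with approximately prescribed values\<close>

text \<open>Zorn's lemma replaces transfinite recursion. The order of \<open>e j\<close> modulo the
  subgroup of its predecessors exceeds \<open>n j\<close>, so its value can still be put within
  \<open>1 / n j\<close> of \<open>t j\<close> when its turn comes.\<close>

lemma partial_character_along:
  fixes e :: "'j \<Rightarrow> 'a::ab_group_add" and t :: "'j \<Rightarrow> real" and n :: "'j \<Rightarrow> nat"
  assumes r: "Well_order r"
    and pos: "\<And>j. j \<in> Field r \<Longrightarrow> n j > 0"
    and e: "\<And>j m. j \<in> Field r \<Longrightarrow> 0 < m \<Longrightarrow> m \<le> n j \<Longrightarrow>
      nmult m (e j) \<notin> group_closure (e ` underS r j)"
  shows "\<exists>f. partial_character f \<and>
    (\<forall>j\<in>Field r. \<exists>z. (e j, circle_of z) \<in> f \<and> real (n j) * \<bar>z - t j\<bar> \<le> 1)"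
proof -
  define good where "good f j \<longleftrightarrow>
    (\<exists>z. (e j, circle_of z) \<in> f \<and> real (n j) * \<bar>z - t j\<bar> \<le> 1)" for f j
  \<comment> \<open>\<open>D\<close> is the initial segment already treated. It is existentially
    quantified in \<open>?A\<close>, so maximality concerns the graph alone.\<close>
  define Q where "Q f D \<longleftrightarrow> D \<subseteq> Field r \<and> (\<forall>j\<in>D. underS r j \<subseteq> D) \<and>
    fst ` f \<subseteq> group_closure (e ` D) \<and> (\<forall>j\<in>D. good f j)" for f D
  let ?A = "{f. partial_character f \<and> (\<exists>D. Q f D)}"
  have "\<exists>M\<in>?A. \<forall>X\<in>?A. M \<subseteq> X \<longrightarrow> X = M"
  proof (rule subset_Zorn_nonempty)
    have "Q {(0, 0)} {}" by (simp add: Q_def)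
    then show "?A \<noteq> {}" using partial_character_trivial by blast
    fix \<C> assume C: "\<C> \<noteq> {}" "subset.chain ?A \<C>"
    then have sub: "\<C> \<subseteq> ?A" by (simp add: subset_chain_def)
    then have "\<forall>f\<in>\<C>. \<exists>D. Q f D" by blast
    \<comment> \<open>The chosen segments need no mutual compatibility, because every clause of
      \<open>Q\<close> passes to unions.\<close>
    from bchoice[OF this] obtain D where "\<forall>f\<in>\<C>. Q f (D f)" ..
    then have D: "D f \<subseteq> Field r" "\<forall>j\<in>D f. underS r j \<subseteq> D f"
      "fst ` f \<subseteq> group_closure (e ` D f)" "\<forall>j\<in>D f. good f j" if "f \<in> \<C>" for f
      using that by (simp_all add: Q_def)
    let ?D = "\<Union>f\<in>\<C>. D f"
    have "Q (\<Union>\<C>) ?D"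
      unfolding Q_def
    proof (intro conjI ballI)
      show "?D \<subseteq> Field r" using D(1) by blast
      show "underS r j \<subseteq> ?D" if "j \<in> ?D" for j
        using D(2) that by blast
      show "good (\<Union>\<C>) j" if j: "j \<in> ?D" for j
      proof -
        obtain f where f: "f \<in> \<C>" "j \<in> D f" using j by blast
        then have "good f j" using D(4) by blast
        then show ?thesis using f(1) unfolding good_def by blast
      qed
      show "fst ` \<Union>\<C> \<subseteq> group_closure (e ` ?D)"
      proof
        fix x assume "x \<in> fst ` \<Union>\<C>"
        then obtain f where f: "f \<in> \<C>" "x \<in> fst ` f" by blast
        then have "x \<in> group_closure (e ` D f)" using D(3) by blast
        moreover have "group_closure (e ` D f) \<subseteq> group_closure (e ` ?D)"
          using f(1) by (intro group_closure_mono image_mono) blast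
        ultimately show "x \<in> group_closure (e ` ?D)" by blast
      qed
    qed
    then show "\<Union>\<C> \<in> ?A" using partial_character_Union[OF C] sub by blast
  qed
  then obtain M where "M \<in> ?A" and max: "\<forall>X\<in>?A. M \<subseteq> X \<longrightarrow> X = M" ..
  then obtain D where M: "partial_character M" and D: "Q M D" by blast
  have "D = Field r"
  proof (rule ccontr)
    assume "D \<noteq> Field r"
    then have ne: "Field r - D \<noteq> {}" using D by (auto simp: Q_def)
    have wo: "wo_rel r" using r by (simp add: wo_rel_def)
    \<comment> \<open>The first untreated index: being an initial segment, \<open>D\<close> must
      equal \<open>underS r j\<close>, so the freeness assumption on \<open>e j\<close> applies to
      the domain of \<open>M\<close>.\<close>
    define j where "j = wo_rel.minim r (Field r - D)"
    have j: "j \<in> Field r" "j \<notin> D"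
      using wo_rel.minim_in[OF wo _ ne] by (auto simp: j_def)
    have min: "(j, i) \<in> r" if "i \<in> Field r - D" for i
      unfolding j_def using wo_rel.minim_least[OF wo _ that] by blast
    have antisym: "antisym r" and total: "total_on (Field r) r"
      using wo by (rule wo_rel.ANTISYM, rule wo_rel.TOTAL)
    have "underS r j \<subseteq> D"
    proof
      fix i assume i: "i \<in> underS r j"
      then have "i \<in> Field r" "i \<noteq> j" "(i, j) \<in> r" by (auto simp: underS_def Field_def)
      then show "i \<in> D" using min[of i] antisym by (auto dest: antisymD)
    qed
    moreover have "D \<subseteq> underS r j"
    proof
      fix i assume i: "i \<in> D"
      then have "i \<in> Field r" "i \<noteq> j" "j \<notin> underS r i" using D j by (auto simp: Q_def)
      then show "i \<in> underS r j"
        using total j(1) by (auto simp: underS_def total_on_def)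
    qed
    ultimately have Dj: "D = underS r j" by blast
    have dom: "fst ` M \<subseteq> group_closure (e ` underS r j)" using D Dj by (simp add: Q_def)
    have notin: "nmult m (e j) \<notin> fst ` M" if "0 < m" "m \<le> n j" for m
      using e[OF j(1) that] dom by blast
    obtain f' z where f': "partial_character f'" "M \<subseteq> f'"
      "(e j, circle_of z) \<in> f'" "real (n j) * \<bar>z - t j\<bar> \<le> 1"
      "fst ` f' \<subseteq> group_closure (insert (e j) (fst ` M))"
      using partial_character_insert[OF M notin] by blast
    have "group_closure (insert (e j) (fst ` M)) \<subseteq> group_closure (e ` insert j D)"
    proof
      have "e ` D \<subseteq> e ` insert j D" by blast
      then have sub: "group_closure (e ` D) \<subseteq> group_closure (e ` insert j D)"
        by (rule group_closure_mono)
      fix x assume "x \<in> group_closure (insert (e j) (fst ` M))"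
      then show "x \<in> group_closure (e ` insert j D)"
      proof induction
        case (base s)
        then show ?case using sub dom Dj group_closure.base[of _ "e ` insert j D"] by blast
      qed (rule group_closure.diff)
    qed
    moreover have "\<forall>i\<in>insert j D. good f' i"
      using f'(2,3,4) D unfolding Q_def good_def by blast
    moreover have "\<forall>i\<in>insert j D. underS r i \<subseteq> insert j D"
      using D Dj unfolding Q_def by blast
    moreover have "insert j D \<subseteq> Field r" using D j(1) by (auto simp: Q_def)
    ultimately have "Q f' (insert j D)" unfolding Q_def using f'(5) by blast
    \<comment> \<open>Maximality puts \<open>e j\<close> into the domain of \<open>M\<close>,
      against freeness for \<open>m = 1\<close>, which is in range because
      \<open>n j > 0\<close>.\<close>
    then have "f' = M" using max f'(1,2) by blast
    then have "e j \<in> fst ` M" using f'(3) by force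
    then show False using notin[of "Suc 0"] pos[OF j(1)] by simp
  qed
  then have "\<forall>j\<in>Field r. good M j" using D by (simp add: Q_def)
  then show ?thesis using M unfolding good_def by blast
qed

section \<open>Cardinality and density\<close>

lemma natLeq_ordLeq_card_of_iff: "natLeq \<le>o |A| \<longleftrightarrow> infinite A"
  using infinite_iff_natLeq_ordLeq[of A] by argo

lemma card_of_Times_ordLeq:
  assumes "infinite B" "|A| \<le>o |B|" "|C| \<le>o |B|"
  shows "|A \<times> C| \<le>o |B|"
  using assms(3) by (simp add: card_of_Sigma_ordLeq_infinite[OF assms(1,2)])

lemma card_of_lists_ordLeq:
  assumes B: "infinite B" and "|A| \<le>o |B|"
  shows "|lists A| \<le>o |B|"
proof -
  let ?L = "\<lambda>n. {xs \<in> lists A. length xs = n}"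
  have L: "|?L n| \<le>o |B|" for n
  proof (induction n)
    case 0
    have "?L 0 = {[]}" by auto
    moreover have "B \<noteq> {}" using B by auto
    ultimately show ?case by (simp add: card_of_singl_ordLeq)
  next
    case (Suc n)
    have "?L (Suc n) = (\<lambda>(x, xs). x # xs) ` (A \<times> ?L n)"
      by (auto simp: length_Suc_conv image_iff)
    moreover have "|A \<times> ?L n| \<le>o |B|"
      using card_of_Times_ordLeq[OF B assms(2) Suc] .
    ultimately show ?case
      by (simp only:) (rule ordLeq_transitive[OF card_of_image])
  qed
  have "lists A = (\<Union>n\<in>UNIV. ?L n)" by auto
  moreover have "|\<Union>n\<in>UNIV. ?L n| \<le>o |B|"
    using L by (intro card_of_UNION_ordLeq_infinite[OF B iffD1[OF infinite_iff_card_of_nat B]]) simp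
  ultimately show ?thesis by simp
qed

text \<open>Differences of two finite sums from \<open>A\<close> are closed under subtraction, so
  pairs of lists over \<open>A\<close> exhaust the subgroup.\<close>

lemma card_of_group_closure_ordLeq:
  assumes B: "infinite B" and A: "|A| \<le>o |B|"
  shows "|group_closure A| \<le>o |B|"
proof -
  let ?f = "\<lambda>(xs, ys). sum_list xs - sum_list ys"
  have "group_closure A \<subseteq> ?f ` (lists A \<times> lists A)"
  proof
    fix x assume "x \<in> group_closure A"
    then show "x \<in> ?f ` (lists A \<times> lists A)"
    proof induction
      \<comment> \<open>The rule \<open>base\<close> also yields 0, possibly outside
        \<open>A\<close>; a pair of empty lists represents it.\<close>
      case (base s)
      show ?case
      proof (cases "s = 0")
        case True
        then show ?thesis by (intro image_eqI[of _ _ "([], [])"]) auto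
      next
        case False
        then show ?thesis using base by (intro image_eqI[of _ _ "([s], [])"]) auto
      qed
    next
      case (diff s t)
      then obtain xs ys xs' ys' where "s = sum_list xs - sum_list ys"
        "t = sum_list xs' - sum_list ys'"
        "{xs, ys, xs', ys'} \<subseteq> lists A" by auto
      then show ?case by (intro image_eqI[of _ _ "(xs @ ys', ys @ xs')"]) auto
    qed
  qed
  then have "|group_closure A| \<le>o |lists A \<times> lists A|"
    by (rule ordLeq_transitive[OF card_of_mono1 card_of_image])
  moreover have "|lists A \<times> lists A| \<le>o |B|"
    by (rule card_of_Times_ordLeq[OF B card_of_lists_ordLeq[OF assms] card_of_lists_ordLeq[OF assms]])
  ultimately show ?thesis by (rule ordLeq_transitive)
qed

lemma wide_iff_card_nmult:
  fixes S :: "'a::ab_group_add set"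
  assumes \<tau>: "Card_order \<tau>" and unc: "natLeq <o \<tau>"
  shows "wide \<tau> S \<longleftrightarrow> (\<forall>n>0. \<tau> \<le>o |nmult n ` S| )"
proof
  have wo: "Well_order \<tau>" using \<tau> by (rule card_order_on_well_order_on)
  assume W: "wide \<tau> S"
  show "\<forall>n>0. \<tau> \<le>o |nmult n ` S|"
  proof (intro allI impI, rule ccontr)
    fix n :: nat assume n: "n > 0" "\<not> \<tau> \<le>o |nmult n ` S|"
    then have less: "|nmult n ` S| <o \<tau>"
      using not_ordLeq_iff_ordLess[OF card_of_Well_order[of "nmult n ` S"] wo] by simp
    \<comment> \<open>A transversal for multiplication by \<open>n\<close>: it has the size of
      \<open>n S\<close>, yet the subgroup it generates contains all of \<open>n S\<close>. A value
      of \<open>|n S|\<close> below the bound would therefore refute wideness.\<close>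
    obtain S' where S': "S' \<subseteq> S" "inj_on (nmult n) S'" "nmult n ` S' = nmult n ` S"
      using subset_image_inj[of "nmult n ` S" "nmult n" S] by auto
    then have "bij_betw (nmult n) S' (nmult n ` S)" by (simp add: bij_betw_def)
    then have "|S'| =o |nmult n ` S|" by (rule card_of_ordIsoI)
    then have "|S'| <o \<tau>" by (rule ordIso_ordLess_trans[OF _ less])
    then have "nmult n ` S' - group_closure S' \<noteq> {}"
      using W n(1) S'(1) unfolding wide_def S'(3) by simp
    then obtain x where "x \<in> nmult n ` S'" "x \<notin> group_closure S'" by blast
    moreover have "nmult n s \<in> group_closure S'" if "s \<in> S'" for s
      using zmult_in_group_closure[of s S' "int n"] that by (simp add: group_closure.base)
    ultimately show False by blast
  qed
next
  assume C: "\<forall>n>0. \<tau> \<le>o |nmult n ` S|"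
  show "wide \<tau> S"
    unfolding wide_def
  proof (intro allI impI notI)
    fix n :: nat and S' assume n: "n > 0" and S': "S' \<subseteq> S" "|S'| <o \<tau>"
      and empty: "nmult n ` S - group_closure S' = {}"
    from C n have "\<tau> \<le>o |nmult n ` S|" by simp
    also have "|nmult n ` S| \<le>o |group_closure S'|"
      using empty by (intro card_of_mono1) blast
    finally have le: "\<tau> \<le>o |group_closure S'|" .
    show False
    \<comment> \<open>A finite \<open>S'\<close> generates a countable subgroup, smaller than the
      uncountable \<open>\<tau>\<close>; an infinite one generates a subgroup no larger than
      itself.\<close>
    proof (cases "finite S'")
      case True
      then have "|S'| \<le>o |UNIV :: nat set|"
        by (intro ordLess_imp_ordLeq) (simp add: finite_iff_ordLess_natLeq
            ordLess_ordIso_trans[OF _ ordIso_symmetric[OF card_of_nat]])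
      then have "|group_closure S'| \<le>o |UNIV :: nat set|"
        by (intro card_of_group_closure_ordLeq) auto
      then have "\<tau> \<le>o natLeq"
        by (rule ordLeq_ordIso_trans[OF ordLeq_transitive[OF le] card_of_nat])
      then show False using not_ordLess_ordLeq[OF unc] by simp
    next
      case False
      then have "|group_closure S'| \<le>o |S'|"
        by (intro card_of_group_closure_ordLeq) (auto simp: card_of_mono1)
      from ordLeq_transitive[OF le this] show False using not_ordLess_ordLeq[OF S'(2)] by simp
    qed
  qed
qed

section \<open>Dense subsets of powers of the circle\<close>

lemma card_of_Pow_cexp: "|Pow A| =o ctwo ^c |A|"
  using card_of_Pow_Func[of A] by (simp add: cexp_def ctwo_def Field_card_of)

text \<open>
  The arc \<open>(0, 1/2)\<close> separates the coordinates \<open>k\<close> and \<open>l\<close> of some point \<open>n s\<close>, because the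
  \<open>k\<close>-th coordinate of \<open>s\<close> can be taken in \<open>(0, 1/2n)\<close> and the \<open>l\<close>-th in \<open>(1/2n, 1/n)\<close>.
\<close>

lemma dense_image_imp_card_le:
  fixes \<phi> :: "'a::ab_group_add \<Rightarrow> 'k \<Rightarrow> circle"
  assumes add: "Modules.additive \<phi>" and dense: "closure (\<phi> ` S) = UNIV" and n: "n > 0"
  shows "|UNIV :: 'k set| \<le>o ctwo ^c |nmult n ` S|"
proof -
  define P where "P k = {x \<in> nmult n ` S. \<phi> x k \<in> circle_of ` {0<..<1/2}}" for k
  have P_ne: "P k \<noteq> P l" if "k \<noteq> l" for k l
  proof -
    define W where "W = circle_of ` {0<..<1 / (2 * real n)}"
    define W' where "W' = circle_of ` {1 / (2 * real n)<..<1 / real n}"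
    define V where "V = (\<lambda>f. f k) -` W \<inter> (\<lambda>f. f l) -` W'"
    have "open V"
      unfolding V_def W_def W'_def
      by (intro open_Int open_vimage open_circle_of_image continuous_on_product_coordinates) auto
    \<comment> \<open>Midpoints of the two arcs, used to show that the open set \<open>V\<close> is
      nonempty.\<close>
    have "1 / (4 * real n) \<in> {0<..<1 / (2 * real n)}"
      "3 / (4 * real n) \<in> {1 / (2 * real n)<..<1 / real n}"
      using n by (auto simp: field_simps)
    then have "(\<lambda>i. circle_of (if i = k then 1 / (4 * real n) else 3 / (4 * real n))) \<in> V"
      using that unfolding V_def W_def W'_def by auto
    then have "V \<inter> \<phi> ` S \<noteq> {}"
      using \<open>open V\<close> dense open_Int_closure_eq_empty[of V "\<phi> ` S"] by auto
    then obtain s u v where s: "s \<in> S" and u: "0 < u" "u < 1 / (2 * real n)" "\<phi> s k = circle_of u"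
      and v: "1 / (2 * real n) < v" "v < 1 / real n" "\<phi> s l = circle_of v"
      by (auto simp: V_def W_def W'_def)
    have nmult_fun: "nmult m f i = nmult m (f i)" for m i and f :: "'k \<Rightarrow> circle"
      by (induction m) auto
    have "\<phi> (nmult n s) k = circle_of (n * u)" "\<phi> (nmult n s) l = circle_of (n * v)"
      using u v by (simp_all add: additive_nmult[OF add] nmult_fun nmult_circle_of)
    moreover have "n * u \<in> {0<..<1/2}" "1/2 < n * v" "n * v < 1"
      using u v n by (auto simp: field_simps)
    moreover have "circle_of (n * v) \<notin> circle_of ` {0<..<1/2}"
    proof
      assume "circle_of (n * v) \<in> circle_of ` {0<..<1/2}"
      then obtain w where w: "0 < w" "w < 1/2" "n * v - w \<in> \<int>"
        by (auto simp: circle_of_eq_iff)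
      then obtain i where "n * v - w = of_int i" by (auto elim: Ints_cases)
      then have "0 < real_of_int i" "real_of_int i < 1"
        using w \<open>1/2 < n * v\<close> \<open>n * v < 1\<close> by linarith+
      then have "0 < i" "i < 1" by simp_all
      then show False by simp
    qed
    ultimately have "nmult n s \<in> P k" "nmult n s \<notin> P l"
      using s by (auto simp: P_def)
    then show ?thesis by blast
  qed
  have "inj P" using P_ne by (meson injI)
  moreover have "range P \<subseteq> Pow (nmult n ` S)" by (auto simp: P_def)
  ultimately have "|UNIV :: 'k set| \<le>o |Pow (nmult n ` S)|"
    using card_of_ordLeqI[of P] by (auto simp: image_subset_iff)
  then show ?thesis by (rule ordLeq_ordIso_trans[OF _ card_of_Pow_cexp])
qed

text \<open>
  The family of Hewitt, Marczewski and Pondiczery: index a point by a finite list \<open>F\<close> in \<open>A\<close>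
  and a finite table of values, and look up the trace of \<open>h k\<close> on \<open>F\<close> in the table.
\<close>

lemma dense_family:
  fixes h :: "'k \<Rightarrow> 'b set"
  assumes A: "infinite A" and h: "inj h" "range h \<subseteq> Pow A"
  shows "\<exists>(N :: 'b \<Rightarrow> nat) (t :: 'b \<Rightarrow> 'k \<Rightarrow> real). (\<forall>a. N a > 0) \<and>
    (\<forall>K y M. finite K \<longrightarrow> M > 0 \<longrightarrow>
      (\<exists>a\<in>A. N a = M \<and> (\<forall>k\<in>K. real M * \<bar>t a k - y k\<bar> \<le> 1)))"
proof -
  define W where "W = lists A \<times> lists (lists A \<times> (UNIV :: int set)) \<times> (UNIV :: nat set)"
  have countable: "|B :: 'x::countable set| \<le>o |A|" for B
    by (rule ordLeq_transitive[OF card_of_ordLeqI[OF inj_on_subset[OF inj_to_nat subset_UNIV]]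
          iffD1[OF infinite_iff_card_of_nat A]]) simp
  have lists: "|lists A| \<le>o |A|"
    using A by (intro card_of_lists_ordLeq card_of_mono1) auto
  have "|W| \<le>o |A|"
    unfolding W_def
    by (intro card_of_Times_ordLeq card_of_lists_ordLeq A lists countable)
  moreover have "W \<noteq> {}" by (auto simp: W_def)
  ultimately obtain g where g: "g ` A = W"
    using card_of_ordLeq2 by metis
  \<comment> \<open>The successor keeps every precision positive; a desired precision
    \<open>M\<close> is therefore encoded as \<open>M - 1\<close>.\<close>
  define N where "N a = Suc (snd (snd (g a)))" for a
  define key where "key F k = filter (\<lambda>a. a \<in> h k) F" for F k
  \<comment> \<open>The value 0 is a default for traces absent from the table; for the finitely many
    coordinates of \<open>K\<close> the table has an entry.\<close>
  define t where "t a k = (case map_of (fst (snd (g a))) (key (fst (g a)) k) of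
      Some i \<Rightarrow> of_int i / real (N a) | None \<Rightarrow> 0)" for a k
  have "\<exists>a\<in>A. N a = M \<and> (\<forall>k\<in>K. real M * \<bar>t a k - y k\<bar> \<le> 1)"
    if K: "finite K" and M: "M > 0" for K and y :: "'k \<Rightarrow> real" and M
  proof -
    have "\<exists>a\<in>A. (a \<in> h k) \<noteq> (a \<in> h l)" if "k \<noteq> l" for k l
      using h that by (metis PowD injD rangeI subsetD subset_antisym subsetI)
    then obtain d where d: "\<And>k l. k \<noteq> l \<Longrightarrow> d k l \<in> A \<and> (d k l \<in> h k) \<noteq> (d k l \<in> h l)"
      by metis
    \<comment> \<open>One separating element for each pair of coordinates in \<open>K\<close>, so
      that distinct coordinates have distinct traces on \<open>D\<close> and the table below is well
      defined.\<close>
    define D where "D = (\<lambda>(k, l). d k l) ` {(k, l) \<in> K \<times> K. k \<noteq> l}"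
    have "finite {(k, l) \<in> K \<times> K. k \<noteq> l}"
      by (rule finite_subset[of _ "K \<times> K"]) (auto simp: K)
    then have "finite D" "D \<subseteq> A" using d by (auto simp: D_def)
    then obtain F where F: "set F = D" using finite_list by blast
    have inj: "inj_on (key F) K"
    proof (rule inj_onI, rule ccontr)
      fix k l assume kl: "k \<in> K" "l \<in> K" "key F k = key F l" "k \<noteq> l"
      then have "set (key F k) = set (key F l)" by simp
      then have "D \<inter> h k = D \<inter> h l" by (auto simp: key_def F)
      moreover have "d k l \<in> D" using kl by (auto simp: D_def)
      ultimately show False using d[OF kl(4)] by blast
    qed
    obtain ks where ks: "set ks = K" "distinct ks" using finite_distinct_list[OF K] by blast
    define p where "p = map (\<lambda>k. (key F k, \<lfloor>real M * y k\<rfloor>)) ks"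
    have "(F, p, M - 1) \<in> W"
      using F \<open>D \<subseteq> A\<close> by (auto simp: W_def p_def key_def subset_iff)
    then obtain a where a: "a \<in> A" "g a = (F, p, M - 1)" using g by (metis imageE)
    have Na: "N a = M" using a M by (simp add: N_def)
    have "real M * \<bar>t a k - y k\<bar> \<le> 1" if k: "k \<in> K" for k
    proof -
      have "distinct (map fst p)"
        using ks inj by (simp add: p_def comp_def distinct_map)
      moreover have "(key F k, \<lfloor>real M * y k\<rfloor>) \<in> set p" using k ks by (auto simp: p_def)
      ultimately have "map_of p (key F k) = Some \<lfloor>real M * y k\<rfloor>" by simp
      then have "real M * t a k = of_int \<lfloor>real M * y k\<rfloor>"
        using M by (simp add: t_def a Na)
      moreover have "real M * \<bar>t a k - y k\<bar> = \<bar>real M * t a k - real M * y k\<bar>"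
        by (metis abs_mult abs_of_nat right_diff_distrib)
      ultimately show ?thesis by linarith
    qed
    then show ?thesis using a(1) Na by blast
  qed
  moreover have "\<forall>a. N a > 0" by (simp add: N_def)
  ultimately show ?thesis by (intro exI[of _ N] exI[of _ t]) simp
qed

section \<open>From wideness to a dense image\<close>

lemma wide_imp_sequence:
  fixes S :: "'a::ab_group_add set" and N :: "'b \<Rightarrow> nat"
  assumes \<tau>: "Card_order \<tau>" and W: "wide \<tau> S"
  shows "\<exists>s. \<forall>a\<in>Field \<tau>. s a \<in> S \<and>
    (\<forall>m. 0 < m \<and> m \<le> N a \<longrightarrow> nmult m (s a) \<notin> group_closure (s ` underS \<tau> a))"
proof -
  \<comment> \<open>Avoiding the single multiple \<open>fact (N a)\<close> avoids every
    \<open>m\<close> up to \<open>N a\<close>, since \<open>m\<close> divides it and subgroups are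
    closed under multiples. The guard on \<open>a\<close> makes the choice possible at every
    index.\<close>
  define P where "P s a x \<longleftrightarrow> (a \<in> Field \<tau> \<longrightarrow>
    x \<in> S \<and> nmult (fact (N a)) x \<notin> group_closure (s ` underS \<tau> a))" for s a x
  have under: "b \<in> underS \<tau> a \<longleftrightarrow> (b, a) \<in> \<tau> - Id" for a b by (auto simp: underS_def)
  have "\<exists>s. \<forall>a. P s a (s a)"
  proof (rule dependent_wf_choice)
    show "wf (\<tau> - Id)"
      using \<tau> by (simp add: card_order_on_def well_order_on_def)
    show "P s a x = P s' a x" if "\<And>b. (b, a) \<in> \<tau> - Id \<Longrightarrow> s b = s' b" for s s' a x
    proof -
      have "s ` underS \<tau> a = s' ` underS \<tau> a" using that under by (intro image_cong) auto
      then show ?thesis by (simp add: P_def)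
    qed
    show "\<exists>x. P s a x" if s: "\<And>b. (b, a) \<in> \<tau> - Id \<Longrightarrow> P s b (s b)" for s a
    proof (cases "a \<in> Field \<tau>")
      case True
      have "s ` underS \<tau> a \<subseteq> S"
      proof
        fix x assume "x \<in> s ` underS \<tau> a"
        then obtain b where b: "x = s b" "b \<in> underS \<tau> a" by blast
        then have "b \<in> Field \<tau>" by (auto simp: underS_def Field_def)
        then show "x \<in> S" using s[of b] b under by (simp add: P_def)
      qed
      \<comment> \<open>Proper initial segments of a cardinal are strictly smaller than it, so
        wideness applies to the earlier choices.\<close>
      moreover have "|s ` underS \<tau> a| <o \<tau>"
        using card_of_image card_of_underS[OF \<tau> True] ordLeq_ordLess_trans by blast
      moreover have "(fact (N a) :: nat) > 0" by simp
      ultimately show ?thesis using W unfolding wide_def P_def by blast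
    qed (simp add: P_def)
  qed
  then obtain s where s: "\<And>a. P s a (s a)" by blast
  have "nmult m (s a) \<notin> group_closure (s ` underS \<tau> a)"
    if "a \<in> Field \<tau>" and m: "0 < m" "m \<le> N a" for a m
  proof
    assume *: "nmult m (s a) \<in> group_closure (s ` underS \<tau> a)"
    have "m dvd fact (N a)" using m by (simp add: dvd_fact)
    then obtain q where "fact (N a) = q * m" by (metis dvd_def mult.commute)
    then have "nmult (fact (N a)) (s a) = zmult (int q) (nmult m (s a))"
      by (simp add: nmult_mult)
    then show False
      using s[of a] that(1) zmult_in_group_closure[OF *] unfolding P_def by metis
  qed
  moreover have "s a \<in> S" if "a \<in> Field \<tau>" for a using s[of a] that by (simp add: P_def)
  ultimately show ?thesis by (intro exI[of _ s]) simp
qed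

text \<open>One sequence \<open>s\<close> serves all coordinates: each coordinate \<open>k\<close>
  receives its own character with targets \<open>t a k\<close>, and the precision \<open>N a\<close>
  does not depend on \<open>k\<close>. The index set embeds into the subsets of
  \<open>Field \<tau>\<close>, as \<open>dense_family\<close> requires.\<close>

lemma wide_imp_dense_image:
  fixes S :: "'a::ab_group_add set" and \<tau> :: "'b rel"
  assumes \<tau>: "Card_order \<tau>" "natLeq \<le>o \<tau>" and \<kappa>: "|UNIV :: 'k set| \<le>o ctwo ^c \<tau>"
    and W: "wide \<tau> S"
  shows "\<exists>\<phi> :: 'a \<Rightarrow> 'k \<Rightarrow> circle. Modules.additive \<phi> \<and> closure (\<phi> ` S) = UNIV"
proof -
  let ?A = "Field \<tau>"
  have iso: "|?A| =o \<tau>" using \<tau>(1) by (rule card_of_Field_ordIso)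
  have A: "infinite ?A"
    using ordLeq_ordIso_trans[OF \<tau>(2) ordIso_symmetric[OF iso]]
    by (rule natLeq_ordLeq_card_of_iff[THEN iffD1])
  have "ctwo ^c \<tau> = |Func ?A (UNIV :: bool set)|"
    by (simp add: cexp_def ctwo_def Field_card_of)
  then have "|UNIV :: 'k set| \<le>o |Pow ?A|"
    using ordLeq_ordIso_trans[OF \<kappa>] ordIso_symmetric[OF card_of_Pow_Func[of ?A]] by simp
  then obtain h :: "'k \<Rightarrow> 'b set" where h: "inj h" "range h \<subseteq> Pow ?A"
    using card_of_ordLeq[of "UNIV :: 'k set" "Pow ?A"] by auto
  from dense_family[OF A h] obtain N :: "'b \<Rightarrow> nat" and t :: "'b \<Rightarrow> 'k \<Rightarrow> real"
    where Nt: "(\<forall>a. N a > 0) \<and> (\<forall>K y M. finite K \<longrightarrow> M > 0 \<longrightarrow>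
      (\<exists>a\<in>?A. N a = M \<and> (\<forall>k\<in>K. real M * \<bar>t a k - y k\<bar> \<le> 1)))"
    by (elim exE)
  have N: "N a > 0" for a using Nt by simp
  have t: "\<exists>a\<in>?A. N a = M \<and> (\<forall>k\<in>K. real M * \<bar>t a k - y k\<bar> \<le> 1)"
    if "finite K" "M > 0" for K y M
    using Nt that by simp
  obtain s where s_all: "\<forall>a\<in>?A. s a \<in> S \<and>
      (\<forall>m. 0 < m \<and> m \<le> N a \<longrightarrow> nmult m (s a) \<notin> group_closure (s ` underS \<tau> a))"
    using wide_imp_sequence[OF \<tau>(1) W] ..
  have s: "s a \<in> S" if "a \<in> ?A" for a using bspec[OF s_all that] ..
  have free: "nmult m (s a) \<notin> group_closure (s ` underS \<tau> a)"
    if "a \<in> ?A" "0 < m" "m \<le> N a" for a m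
    using bspec[OF s_all that(1)] that(2,3) by (auto simp only:)
  have "\<exists>\<psi>. Modules.additive \<psi> \<and>
    (\<forall>a\<in>?A. \<exists>z. \<psi> (s a) = circle_of z \<and> real (N a) * \<bar>z - t a k\<bar> \<le> 1)" for k
  proof -
    have "\<exists>f. partial_character f \<and>
      (\<forall>a\<in>?A. \<exists>z. (s a, circle_of z) \<in> f \<and> real (N a) * \<bar>z - t a k\<bar> \<le> 1)"
      using card_order_on_well_order_on[OF \<tau>(1)] N free by (rule partial_character_along)
    then obtain f where f: "partial_character f"
      "\<forall>a\<in>?A. \<exists>z. (s a, circle_of z) \<in> f \<and> real (N a) * \<bar>z - t a k\<bar> \<le> 1"
      by (elim exE conjE)
    obtain \<psi> where "Modules.additive \<psi>" and "\<forall>(x, y)\<in>f. \<psi> x = y"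
      using partial_character_extend_UNIV[OF f(1)] by (elim exE conjE)
    with f(2) show ?thesis by fast
  qed
  then have "\<forall>k. \<exists>\<psi>. Modules.additive \<psi> \<and>
    (\<forall>a\<in>?A. \<exists>z. \<psi> (s a) = circle_of z \<and> real (N a) * \<bar>z - t a k\<bar> \<le> 1)" by blast
  from choice[OF this] obtain \<psi> where \<psi>: "\<And>k. Modules.additive (\<psi> k)"
    and approx: "\<And>k a. a \<in> ?A \<Longrightarrow>
      \<exists>z. \<psi> k (s a) = circle_of z \<and> real (N a) * \<bar>z - t a k\<bar> \<le> 1"
    by blast
  define \<phi> where "\<phi> x k = \<psi> k x" for x k
  have "x \<in> closure (\<phi> ` S)" for x
    unfolding closure_iff_nhds_not_empty
  proof (intro allI impI)
    fix V U assume U: "U \<subseteq> V" "open U" "x \<in> U"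
    then obtain X where X: "x \<in> Pi\<^sub>E UNIV X" "\<And>i. open (X i)" "finite {i. X i \<noteq> UNIV}"
      "Pi\<^sub>E UNIV X \<subseteq> U"
      using product_topology_open_contains_basis[of "\<lambda>_. euclidean" UNIV U x]
      by (auto simp: open_fun_def)
    let ?K = "{i. X i \<noteq> UNIV}"
    have "\<forall>k. \<exists>u. x k = circle_of u" using circle_of_surj by simp
    from choice[OF this] obtain y where y: "\<And>k. x k = circle_of (y k)" by blast
    have "\<exists>\<epsilon>>0. ball (y k) \<epsilon> \<subseteq> circle_of -` X k" for k
    proof -
      have "open (circle_of -` X k)" using X(2) by (simp add: open_circle_def)
      moreover have "y k \<in> circle_of -` X k" using X(1) y by auto
      ultimately show ?thesis by (meson open_contains_ball)
    qed
    then obtain \<epsilon> where \<epsilon>: "\<And>k. \<epsilon> k > 0" "\<And>k. ball (y k) (\<epsilon> k) \<subseteq> circle_of -` X k"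
      by metis
    \<comment> \<open>Two errors of at most \<open>1 / M\<close> occur, from \<open>z\<close> to
      \<open>t a k\<close> and from there to \<open>y k\<close>, so \<open>M\<close> must exceed
      \<open>2 / \<epsilon> k\<close> on the restricted coordinates. Taking \<open>max b 0\<close>
      keeps \<open>M\<close> positive even if there are none.\<close>
    have "bdd_above ((\<lambda>k. 2 / \<epsilon> k) ` ?K)" using X(3) by (intro bdd_above_finite) simp
    then obtain b where b: "\<And>k. k \<in> ?K \<Longrightarrow> 2 / \<epsilon> k \<le> b" by (auto simp: bdd_above_def)
    obtain M :: nat where M: "max b 0 < real M" using reals_Archimedean2 by blast
    then obtain a where a: "a \<in> ?A" "N a = M" "\<And>k. k \<in> ?K \<Longrightarrow> real M * \<bar>t a k - y k\<bar> \<le> 1"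
      using t[OF X(3), of M y] by auto
    have "\<phi> (s a) k \<in> X k" for k
    proof (cases "k \<in> ?K")
      case True
      obtain z where z: "\<psi> k (s a) = circle_of z" "real M * \<bar>z - t a k\<bar> \<le> 1"
        using approx[OF a(1)] a(2) by metis
      have "real M * \<bar>z - y k\<bar> \<le> real M * (\<bar>z - t a k\<bar> + \<bar>t a k - y k\<bar>)"
        by (intro mult_left_mono) auto
      also have "\<dots> \<le> 2" using z(2) a(3)[OF True] by (simp add: distrib_left)
      also have "2 < real M * \<epsilon> k"
        using b[OF True] M \<epsilon>(1)[of k] by (auto simp: field_simps intro: le_less_trans)
      finally have "\<bar>z - y k\<bar> < \<epsilon> k" using M by simp
      then have "z \<in> ball (y k) (\<epsilon> k)" by (simp add: dist_real_def abs_minus_commute)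
      then have "z \<in> circle_of -` X k" using \<epsilon>(2)[of k] by blast
      then show ?thesis using z(1) by (simp add: \<phi>_def)
    qed auto
    then have "\<phi> (s a) \<in> V" using X(4) U(1) by auto
    then show "\<phi> ` S \<inter> V \<noteq> {}" using s[OF a(1)] by blast
  qed
  then have "closure (\<phi> ` S) = UNIV" by blast
  moreover have "Modules.additive \<phi>"
    using \<psi> by (auto simp: Modules.additive_def \<phi>_def fun_eq_iff)
  ultimately show ?thesis by (intro exI[of _ \<phi>] conjI)
qed

section \<open>The equivalence\<close>

lemma cexp_natLeq_ordLeq_continuum: "ctwo ^c natLeq \<le>o |UNIV :: real set|"
proof -
  have "|UNIV :: nat set set| =o |UNIV :: real set|"
    using nat_sets_eqpoll_reals by (simp add: eqpoll_iff_card_of_ordIso)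
  moreover have "ctwo ^c natLeq =o |UNIV :: nat set set|"
    using ordIso_symmetric[OF card_of_Pow_Func[of "UNIV :: nat set"]]
    by (simp add: cexp_def ctwo_def Field_natLeq Field_card_of)
  ultimately show ?thesis using ordIso_transitive ordIso_imp_ordLeq by metis
qed

theorem theorem2p5:
  fixes S :: "'g::ab_group_add set"
    and \<kappa> \<tau> :: "'k rel"
  assumes "\<kappa> = |UNIV :: 'k set|"
    and "|UNIV :: real set| <o \<kappa>"
    and "\<tau> = log_card \<kappa>"
  shows "((\<exists>\<phi> :: 'g \<Rightarrow> ('k \<Rightarrow> circle). Modules.additive \<phi> \<and> closure (\<phi> ` S) = UNIV)
            \<longleftrightarrow> \<tau> \<le>o min_card {|nmult n ` S| |n. n > 0})
       \<and> (\<tau> \<le>o min_card {|nmult n ` S| |n. n > 0} \<longleftrightarrow> wide \<tau> S)"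
proof -
  have "infinite (UNIV :: real set)" by (rule infinite_UNIV_char_0)
  then have "natLeq \<le>o |UNIV :: real set|" by (rule natLeq_ordLeq_card_of_iff[THEN iffD2])
  then have nat\<kappa>: "natLeq \<le>o \<kappa>"
    by (rule ordLess_imp_ordLeq[OF ordLeq_ordLess_trans[OF _ assms(2)]])
  have \<kappa>: "Card_order \<kappa>" by (simp add: assms(1) card_of_Card_order)
  note \<tau> = Card_order_log_card[OF \<kappa> nat\<kappa>, folded assms(3)]
    log_card_infinite[OF \<kappa> nat\<kappa>, folded assms(3)]
    log_card_exp[OF \<kappa> nat\<kappa>, folded assms(3)]
  have inf: "infinite (UNIV :: 'k set)"
    using nat\<kappa> unfolding assms(1) by (rule natLeq_ordLeq_card_of_iff[THEN iffD1])
  \<comment> \<open>Otherwise \<open>\<kappa>\<close> would be at most two to the power omega, hence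
    at most the continuum.\<close>
  have unc: "natLeq <o \<tau>"
  proof (rule ccontr)
    assume "\<not> natLeq <o \<tau>"
    then have "\<tau> \<le>o natLeq"
      using not_ordLess_iff_ordLeq[OF card_order_on_well_order_on[OF \<tau>(1)] natLeq_Well_order]
      by simp
    then have "ctwo ^c \<tau> \<le>o ctwo ^c natLeq"
      using \<tau>(1) cinfinite_mono[OF \<tau>(2) natLeq_cinfinite]
      by (intro cexp_mono2_Cnotzero Card_order_ctwo Cinfinite_Cnotzero) simp_all
    from ordLeq_transitive[OF \<tau>(3) ordLeq_transitive[OF this cexp_natLeq_ordLeq_continuum]]
    show False using not_ordLess_ordLeq[OF assms(2)] by simp
  qed
  let ?R = "{|nmult n ` S| |n. n > 0}"
  have R: "?R \<noteq> {}" "\<And>r. r \<in> ?R \<Longrightarrow> Card_order r"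
    using card_of_Card_order by (auto intro: exI[of _ "1 :: nat"])
  have min: "\<tau> \<le>o min_card ?R \<longleftrightarrow> (\<forall>n>0. \<tau> \<le>o |nmult n ` S| )"
  proof (intro iffI allI impI)
    fix n :: nat assume "\<tau> \<le>o min_card ?R" "n > 0"
    moreover from \<open>n > 0\<close> have "|nmult n ` S| \<in> ?R" by blast
    ultimately show "\<tau> \<le>o |nmult n ` S|"
      using ordLeq_transitive[OF _ min_card(2)[OF R]] by simp
  next
    assume "\<forall>n>0. \<tau> \<le>o |nmult n ` S|"
    moreover obtain n where "min_card ?R = |nmult n ` S|" "n > 0"
      using min_card(1)[OF R] by blast
    ultimately show "\<tau> \<le>o min_card ?R" by simp
  qed
  have wide: "wide \<tau> S \<longleftrightarrow> (\<forall>n>0. \<tau> \<le>o |nmult n ` S| )"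
    using wide_iff_card_nmult[OF \<tau>(1) unc] .
  have necessary: "wide \<tau> S"
    if ex: "\<exists>\<phi> :: 'g \<Rightarrow> 'k \<Rightarrow> circle. Modules.additive \<phi> \<and> closure (\<phi> ` S) = UNIV"
    unfolding wide
  proof (intro allI impI)
    fix n :: nat assume "n > 0"
    obtain \<phi> :: "'g \<Rightarrow> 'k \<Rightarrow> circle" where \<phi>: "Modules.additive \<phi>" "closure (\<phi> ` S) = UNIV"
      using ex by (elim exE conjE)
    have le: "\<kappa> \<le>o ctwo ^c |nmult n ` S|"
      using dense_image_imp_card_le[OF \<phi> \<open>n > 0\<close>] by (simp add: assms(1))
    \<comment> \<open>The logarithm is a minimum over infinite cardinals only. A finite
      \<open>n S\<close> would have a finite power set, too small to bound the infinite
      \<open>\<kappa>\<close>.\<close>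
    have "infinite (nmult n ` S)"
    proof
      assume "finite (nmult n ` S)"
      then have "finite (Pow (nmult n ` S))" by simp
      moreover have "\<kappa> \<le>o |Pow (nmult n ` S)|"
        by (rule ordLeq_ordIso_trans[OF le ordIso_symmetric[OF card_of_Pow_cexp]])
      ultimately show False
        using inf card_of_ordLeq_finite[of "UNIV :: 'k set" "Pow (nmult n ` S)"]
        by (simp add: assms(1))
    qed
    then have "natLeq \<le>o |nmult n ` S|" by (rule natLeq_ordLeq_card_of_iff[THEN iffD2])
    then show "\<tau> \<le>o |nmult n ` S|"
      using log_card_least[OF \<kappa> nat\<kappa> card_of_Card_order _ le] assms(3) by simp
  qed
  have sufficient: "\<exists>\<phi> :: 'g \<Rightarrow> 'k \<Rightarrow> circle. Modules.additive \<phi> \<and> closure (\<phi> ` S) = UNIV"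
    if "wide \<tau> S"
    using wide_imp_dense_image[OF \<tau>(1,2) \<tau>(3)[unfolded assms(1)] that] .
  show ?thesis
    unfolding min wide[symmetric] by (intro conjI refl iffI[OF necessary sufficient])
qed

end
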